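(* Let $\mathbb F=\mathbb R$ or $\mathbb C$, let $c$ be a cardinality, let $M$ be a differentiable manifold, let $f:M\to\mathbb F^c$ be an embedding, and let $\mathrm{Ind}(f):\mathrm{Ind}(M)\to\mathrm{Ind}(\mathbb F^c)$ be the induced map $\{x_1,\dots,x_l\}\mapsto\{f(x_1),\dots,f(x_l)\}$. Then for any hypergraph $\mathcal H(M)$ on $M$: (1) $f$ is a (real or complex) affinely regular embedding of $\mathcal H(M)$ if and only if $\mathrm{Ind}(f)$ induces an injective morphism of $\mathcal H(M)$ into $A_\bullet(\mathbb F^c)/\Sigma_\bullet$; (2) $f$ is a (real or complex) regular embedding of $\mathcal H(M)$ if and only if $\mathrm{Ind}(f)$ induces an injective morphism of $\mathcal H(M)$ into $\tilde V_\bullet(\mathbb F^c)/\Sigma_\bullet$.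
   Context: $\mathbb F^c$ is the $c$-fold direct sum of $\mathbb F$. $\mathrm{Ind}(X)$ is the set of all finite subsets of $X$. A hypergraph $\mathcal H(M)$ on $M$ is a union $\bigcup_{k\ge0}\mathcal H_k(M)$ where $\mathcal H_k(M)$ is a submanifold of the unordered configuration space $\mathrm{Conf}_k(M)/\Sigma_k$ of $k$-element subsets of $M$; its elements are called hyperedges ($k$-hyperedges if they have $k$ elements). An embedding $f:M\to\mathbb F^c$ is an affinely regular embedding (also called a geometric realization) of $\mathcal H(M)$, resp. a regular embedding of $\mathcal H(M)$, if for every $k\ge1$ and every $k$-hyperedge $\{x_1,\dots,x_k\}\in\mathcal H(M)$ the vectors $f(x_1),\dots,f(x_k)$ are affinely independent, resp. linearly independent, over $\mathbb F$. $A_\bullet(\mathbb F^c)/\Sigma_\bullet$ (resp. $\tilde V_\bullet(\mathbb F^c)/\Sigma_\bullet$) is the simplicial complex of all finite affinely (resp. linearly) independent subsets of $\mathbb F^c$, regarded as a hypergraph. A morphism of hypergraphs induced by $f$ sends each hyperedge $\sigma$ to the hyperedge $f(\sigma)$. *)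

theory Defs
  imports "HOL-Analysis.Analysis" "HOL-Library.Poly_Mapping"
begin

text \<open>
  Maps of class $C^r$ on an open subset of $\mathbb R^m$, where $\mathbb R^m$ is
  \<^const>\<open>Euclidean_space\<close> (functions \<^typ>\<open>nat \<Rightarrow> real\<close> that vanish from index \<open>m\<close> on).
  The dimension must be a term: configuration spaces of all sizes occur in one statement.
\<close>

definition partial_deriv :: "nat \<Rightarrow> ((nat \<Rightarrow> real) \<Rightarrow> 'k::real_normed_vector) \<Rightarrow> (nat \<Rightarrow> real) \<Rightarrow> 'k"
  where "partial_deriv j g x = vector_derivative (\<lambda>t. g (x(j := t))) (at (x j))"

primrec Cn_on :: "nat \<Rightarrow> nat \<Rightarrow> (nat \<Rightarrow> real) set \<Rightarrow> ((nat \<Rightarrow> real) \<Rightarrow> 'k::real_normed_vector) \<Rightarrow> bool"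
  where
    "Cn_on 0 m U g \<longleftrightarrow> continuous_map (subtopology (Euclidean_space m) U) euclidean g"
  | "Cn_on (Suc q) m U g \<longleftrightarrow>
       continuous_map (subtopology (Euclidean_space m) U) euclidean g \<and>
       (\<forall>j<m. (\<forall>x\<in>U. (\<lambda>t. g (x(j := t))) differentiable (at (x j))) \<and>
              Cn_on q m U (partial_deriv j g))"

definition Cr_on :: "enat \<Rightarrow> nat \<Rightarrow> (nat \<Rightarrow> real) set \<Rightarrow> ((nat \<Rightarrow> real) \<Rightarrow> 'k::real_normed_vector) \<Rightarrow> bool"
  where "Cr_on r m U g \<longleftrightarrow> (\<forall>q. enat q \<le> r \<longrightarrow> Cn_on q m U g)"

type_synonym 'm chart = "'m set \<times> ('m \<Rightarrow> nat \<Rightarrow> real)"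

definition is_chart :: "nat \<Rightarrow> 'm topology \<Rightarrow> 'm chart \<Rightarrow> bool"
  where "is_chart n X = (\<lambda>(U, \<phi>).
    openin X U \<and> openin (Euclidean_space n) (\<phi> ` U) \<and>
    homeomorphic_map (subtopology X U) (subtopology (Euclidean_space n) (\<phi> ` U)) \<phi>)"

definition Cr_transition :: "enat \<Rightarrow> nat \<Rightarrow> 'm chart \<Rightarrow> 'm chart \<Rightarrow> bool"
  where "Cr_transition r n = (\<lambda>(U, \<phi>) (V, \<psi>).
    \<forall>i<n. Cr_on r n (\<phi> ` (U \<inter> V)) (\<lambda>x. \<psi> (inv_into U \<phi> x) i))"

text \<open>An \<open>n\<close>-dimensional manifold of class $C^r$ without boundary, with carrier \<^term>\<open>topspace X\<close>.\<close>

definition Cr_manifold :: "enat \<Rightarrow> nat \<Rightarrow> 'm topology \<Rightarrow> 'm chart set \<Rightarrow> bool"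
  where "Cr_manifold r n X \<A> \<longleftrightarrow>
    Hausdorff_space X \<and> second_countable X \<and>
    (\<forall>a\<in>\<A>. is_chart n X a) \<and> (\<Union>a\<in>\<A>. fst a) = topspace X \<and>
    (\<forall>a\<in>\<A>. \<forall>b\<in>\<A>. Cr_transition r n a b)"

text \<open>
  Embedded submanifolds, by adapted charts from the maximal atlas. Components may have different
  dimensions, and the empty set is a submanifold.
\<close>

definition Cr_submanifold :: "enat \<Rightarrow> nat \<Rightarrow> 'm topology \<Rightarrow> 'm chart set \<Rightarrow> 'm set \<Rightarrow> bool"
  where "Cr_submanifold r n X \<A> S \<longleftrightarrow>
    S \<subseteq> topspace X \<and>
    (\<forall>p\<in>S. \<exists>W \<psi>. \<exists>d\<le>n. p \<in> W \<and> is_chart n X (W, \<psi>) \<and>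
       (\<forall>a\<in>\<A>. Cr_transition r n a (W, \<psi>) \<and> Cr_transition r n (W, \<psi>) a) \<and>
       \<psi> ` (S \<inter> W) = {y \<in> \<psi> ` W. \<forall>i\<ge>d. y i = 0})"

definition Conf :: "'m topology \<Rightarrow> nat \<Rightarrow> (nat \<Rightarrow> 'm) topology"
  where "Conf X k = subtopology (product_topology (\<lambda>_. X) {..<k}) {x. inj_on x {..<k}}"

text \<open>
  The orbit of an ordered configuration \<open>x\<close> under the symmetric group is the \<open>k\<close>-element
  set \<^term>\<open>x ` {..<k}\<close>; the unordered configuration space carries the quotient topology.
\<close>

definition UConf :: "'m topology \<Rightarrow> nat \<Rightarrow> 'm set topology"
  where "UConf X k = topology (\<lambda>W.
    W \<subseteq> (\<lambda>x. x ` {..<k}) ` topspace (Conf X k) \<and>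
    openin (Conf X k) {x \<in> topspace (Conf X k). x ` {..<k} \<in> W})"

lemma openin_UConf:
  "openin (UConf X k) W \<longleftrightarrow>
    W \<subseteq> (\<lambda>x. x ` {..<k}) ` topspace (Conf X k) \<and>
    openin (Conf X k) {x \<in> topspace (Conf X k). x ` {..<k} \<in> W}"
proof -
  let ?C = "Conf X k" and ?q = "\<lambda>x::nat \<Rightarrow> 'a. x ` {..<k}"
  have Int: "{x \<in> topspace ?C. ?q x \<in> A \<inter> B} =
      {x \<in> topspace ?C. ?q x \<in> A} \<inter> {x \<in> topspace ?C. ?q x \<in> B}" for A B
    by auto
  have Un: "{x \<in> topspace ?C. ?q x \<in> \<Union>\<K>} = (\<Union>A\<in>\<K>. {x \<in> topspace ?C. ?q x \<in> A})" for \<K>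
    by auto
  have "istopology (\<lambda>W. W \<subseteq> ?q ` topspace ?C \<and> openin ?C {x \<in> topspace ?C. ?q x \<in> W})"
    unfolding istopology_def
  proof (intro conjI allI impI; (elim conjE)?)
    fix A B
    assume "openin ?C {x \<in> topspace ?C. ?q x \<in> A}" "openin ?C {x \<in> topspace ?C. ?q x \<in> B}"
    then show "openin ?C {x \<in> topspace ?C. ?q x \<in> A \<inter> B}"
      unfolding Int by (rule openin_Int)
  next
    fix \<K>
    assume "\<forall>A\<in>\<K>. A \<subseteq> ?q ` topspace ?C \<and> openin ?C {x \<in> topspace ?C. ?q x \<in> A}"
    then show "openin ?C {x \<in> topspace ?C. ?q x \<in> \<Union>\<K>}"
      unfolding Un by (intro openin_Union) auto
  qed blast+
  then show ?thesis
    by (simp add: UConf_def topology_inverse')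
qed

lemma quotient_map_UConf: "quotient_map (Conf X k) (UConf X k) (\<lambda>x. x ` {..<k})"
proof -
  let ?C = "Conf X k" and ?q = "\<lambda>x::nat \<Rightarrow> 'a. x ` {..<k}"
  have "{x \<in> topspace ?C. ?q x \<in> ?q ` topspace ?C} = topspace ?C"
    by auto
  then have "openin (UConf X k) (?q ` topspace ?C)"
    by (simp add: openin_UConf)
  then have "topspace (UConf X k) = ?q ` topspace ?C"
    using openin_topspace[of "UConf X k"] unfolding openin_UConf[of X k "topspace (UConf X k)"]
    by (auto dest: openin_subset)
  then show ?thesis
    unfolding quotient_map_def by (simp add: openin_UConf[of X k])
qed

lemma topspace_UConf:
  "topspace (UConf X k) = {\<sigma>. \<sigma> \<subseteq> topspace X \<and> finite \<sigma> \<and> card \<sigma> = k}"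
proof -
  have "topspace (UConf X k) = (\<lambda>x. x ` {..<k}) ` topspace (Conf X k)"
    using quotient_imp_surjective_map[OF quotient_map_UConf[of X k]] by simp
  also have "\<dots> = {\<sigma>. \<sigma> \<subseteq> topspace X \<and> finite \<sigma> \<and> card \<sigma> = k}" (is "?L = ?R")
  proof
    show "?L \<subseteq> ?R"
    proof
      fix \<sigma> assume "\<sigma> \<in> ?L"
      then obtain x where x: "\<sigma> = x ` {..<k}" "inj_on x {..<k}" "\<And>i. i < k \<Longrightarrow> x i \<in> topspace X"
        by (auto simp: Conf_def)
      show "\<sigma> \<in> ?R"
        using x(3) card_image[OF x(2)] unfolding x(1) by auto
    qed
  next
    show "?R \<subseteq> ?L"
    proof
      fix \<sigma> assume \<sigma>: "\<sigma> \<in> ?R"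
      then obtain h where h: "bij_betw h {..<k} \<sigma>"
        using ex_bij_betw_nat_finite[of \<sigma>] by (metis (lifting) atLeast0LessThan mem_Collect_eq)
      have im: "restrict h {..<k} ` {..<k} = \<sigma>"
        using bij_betw_imp_surj_on[OF h] by simp
      have inj: "inj_on (restrict h {..<k}) {..<k}"
        using bij_betw_imp_inj_on[OF h] by (simp add: inj_on_restrict_eq)
      have "restrict h {..<k} \<in> (\<Pi>\<^sub>E i\<in>{..<k}. topspace X)"
        using bij_betwE[OF h] \<sigma> by auto
      then have "restrict h {..<k} \<in> topspace (Conf X k)"
        using inj by (simp add: Conf_def)
      then show "\<sigma> \<in> ?L"
        using im by (intro image_eqI[where x = "restrict h {..<k}"]) simp_all
    qed
  qed
  finally show ?thesis .
qed

text \<open>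
  Charts of the unordered configuration space: choose pairwise disjoint open subsets \<open>V 0, \<dots>, V (k - 1)\<close>
  of chart domains of the manifold. The configurations with exactly one point in each \<open>V i\<close> form an
  open set, on which the \<open>k\<close> blocks of \<open>n\<close> coordinates of the points are local coordinates.
\<close>

definition UConf_atlas :: "nat \<Rightarrow> 'm topology \<Rightarrow> 'm chart set \<Rightarrow> nat \<Rightarrow> 'm set chart set"
  where "UConf_atlas n X \<A> k =
    {({x ` {..<k} | x. \<forall>i<k. x i \<in> V i},
      \<lambda>\<sigma> j. if j < n * k then \<phi> (j div n) (the_elem (\<sigma> \<inter> V (j div n))) (j mod n) else 0) | U \<phi> V.
      (\<forall>i<k. (U i, \<phi> i) \<in> \<A> \<and> openin X (V i) \<and> V i \<subseteq> U i) \<and> disjoint_family_on V {..<k}}"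

definition hypergraph_on :: "enat \<Rightarrow> nat \<Rightarrow> 'm topology \<Rightarrow> 'm chart set \<Rightarrow> 'm set set \<Rightarrow> bool"
  where "hypergraph_on r n X \<A> H \<longleftrightarrow>
    (\<exists>Hk. (\<forall>k. Cr_submanifold r (n * k) (UConf X k) (UConf_atlas n X \<A> k) (Hk k)) \<and> H = (\<Union>k. Hk k))"

text \<open>
  The direct sum of copies of a field indexed by a set \<open>I\<close>; the cardinality \<open>c\<close> is that of \<open>I\<close>.
\<close>

definition dsum :: "'i set \<Rightarrow> ('i \<Rightarrow>\<^sub>0 'k::zero) set"
  where "dsum I = {v. Poly_Mapping.keys v \<subseteq> I}"

definition dscale :: "'k::field \<Rightarrow> ('i \<Rightarrow>\<^sub>0 'k) \<Rightarrow> ('i \<Rightarrow>\<^sub>0 'k)"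
  where "dscale a v = Poly_Mapping.map ((*) a) v"

lemma lookup_dscale [simp]: "Poly_Mapping.lookup (dscale a v) i = a * Poly_Mapping.lookup v i"
  by (simp add: dscale_def Poly_Mapping.map.rep_eq when_def)

global_interpretation dvs: vector_space dscale
  by unfold_locales (rule poly_mapping_eqI, simp add: Poly_Mapping.lookup_add algebra_simps)+

text \<open>
  For finite \<open>I\<close> the following singles out the Euclidean topology. For infinite \<open>I\<close> several
  topologies on the direct sum are in use (finite or colimit topology, box topology, topologies
  induced by a norm or by the product); all of them satisfy this condition.
\<close>

definition dsum_topology :: "'i set \<Rightarrow> ('i \<Rightarrow>\<^sub>0 'k::{zero,topological_space}) topology \<Rightarrow> bool"
  where "dsum_topology I T \<longleftrightarrow>
    topspace T = dsum I \<and>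
    (\<forall>J. finite J \<and> J \<subseteq> I \<longrightarrow> subtopology T (dsum J) = pullback_topology (dsum J) Poly_Mapping.lookup euclidean)"

text \<open>
  Embeddings of class $C^s$: homeomorphisms onto the image which, if $s \ge 1$, are in addition of
  class $C^s$ and have injective (real) differentials, both read off in coordinates.
  For $s = 0$ these are the topological embeddings.
\<close>

definition Cs_embedding :: "enat \<Rightarrow> nat \<Rightarrow> 'm topology \<Rightarrow> 'm chart set \<Rightarrow>
    ('i \<Rightarrow>\<^sub>0 'k::real_normed_field) topology \<Rightarrow> ('m \<Rightarrow> 'i \<Rightarrow>\<^sub>0 'k) \<Rightarrow> bool"
  where "Cs_embedding s n X \<A> T f \<longleftrightarrow>
    embedding_map X T f \<and>
    (1 \<le> s \<longrightarrow> (\<forall>(U, \<phi>)\<in>\<A>.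
       let F = (\<lambda>i x. Poly_Mapping.lookup (f (inv_into U \<phi> x)) i) in
         (\<forall>i. Cr_on s n (\<phi> ` U) (F i)) \<and>
         (\<forall>x \<in> \<phi> ` U. \<forall>v::nat \<Rightarrow> real.
            (\<forall>i. (\<Sum>j<n. v j *\<^sub>R partial_deriv j (F i) x) = 0) \<longrightarrow> (\<forall>j<n. v j = 0))))"

text \<open>
  Independence of the family \<open>(f x)\<close> indexed by the finite set \<open>\<sigma>\<close>, repetitions counting as dependent.
\<close>

definition linearly_independent_family :: "('m \<Rightarrow> 'i \<Rightarrow>\<^sub>0 'k::field) \<Rightarrow> 'm set \<Rightarrow> bool"
  where "linearly_independent_family f \<sigma> \<longleftrightarrow>
    (\<forall>a. (\<Sum>x\<in>\<sigma>. dscale (a x) (f x)) = 0 \<longrightarrow> (\<forall>x\<in>\<sigma>. a x = 0))"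

definition affinely_independent_family :: "('m \<Rightarrow> 'i \<Rightarrow>\<^sub>0 'k::field) \<Rightarrow> 'm set \<Rightarrow> bool"
  where "affinely_independent_family f \<sigma> \<longleftrightarrow>
    (\<forall>a. (\<Sum>x\<in>\<sigma>. a x) = 0 \<and> (\<Sum>x\<in>\<sigma>. dscale (a x) (f x)) = 0 \<longrightarrow> (\<forall>x\<in>\<sigma>. a x = 0))"

definition affinely_regular_embedding :: "enat \<Rightarrow> nat \<Rightarrow> 'm topology \<Rightarrow> 'm chart set \<Rightarrow>
    ('i \<Rightarrow>\<^sub>0 'k::real_normed_field) topology \<Rightarrow> 'm set set \<Rightarrow> ('m \<Rightarrow> 'i \<Rightarrow>\<^sub>0 'k) \<Rightarrow> bool"
  where "affinely_regular_embedding s n X \<A> T H f \<longleftrightarrow>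
    Cs_embedding s n X \<A> T f \<and> (\<forall>\<sigma>\<in>H. 1 \<le> card \<sigma> \<longrightarrow> affinely_independent_family f \<sigma>)"

definition regular_embedding :: "enat \<Rightarrow> nat \<Rightarrow> 'm topology \<Rightarrow> 'm chart set \<Rightarrow>
    ('i \<Rightarrow>\<^sub>0 'k::real_normed_field) topology \<Rightarrow> 'm set set \<Rightarrow> ('m \<Rightarrow> 'i \<Rightarrow>\<^sub>0 'k) \<Rightarrow> bool"
  where "regular_embedding s n X \<A> T H f \<longleftrightarrow>
    Cs_embedding s n X \<A> T f \<and> (\<forall>\<sigma>\<in>H. 1 \<le> card \<sigma> \<longrightarrow> linearly_independent_family f \<sigma>)"

definition Ind :: "'a set \<Rightarrow> 'a set set"
  where "Ind X = {\<sigma>. finite \<sigma> \<and> \<sigma> \<subseteq> X}"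

definition Ind_map :: "('a \<Rightarrow> 'b) \<Rightarrow> 'a set \<Rightarrow> 'b set"
  where "Ind_map f \<sigma> = f ` \<sigma>"

text \<open>
  The complexes of finite affinely, resp. linearly, independent subsets, the empty set included.
\<close>

definition A_complex :: "'i set \<Rightarrow> ('i \<Rightarrow>\<^sub>0 'k::field) set set"
  where "A_complex I = {S \<in> Ind (dsum I). affinely_independent_family (\<lambda>v. v) S}"

definition V_complex :: "'i set \<Rightarrow> ('i \<Rightarrow>\<^sub>0 'k::field) set set"
  where "V_complex I = {S \<in> Ind (dsum I). dvs.independent S}"

definition induces_injective_morphism :: "('a \<Rightarrow> 'b) \<Rightarrow> 'a set set \<Rightarrow> 'b set set \<Rightarrow> bool"
  where "induces_injective_morphism f H K \<longleftrightarrow>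
    Ind_map f ` H \<subseteq> K \<and> inj_on (Ind_map f) H"

end

theory Submission
  imports Defs
begin

text \<open>An embedding is injective, and hyperedges are finite subsets of the carrier, since they
  are points of unordered configuration spaces. A set of points in the domain of an injective map is
  determined by its image, so \<open>Ind_map f\<close> is automatically injective on
  \<open>H\<close>. As \<open>f\<close> maps \<open>\<sigma>\<close> bijectively onto
  \<open>f\<close> \<sigma>\<open>, independence of the indexed family of the\<close>f
  x\<open>is the same as independence of the set\<close>f \<open>\<sigma>\<close>; this is the
  content of \<open>linearly_independent_family_image\<close> and
  \<open>affinely_independent_family_image\<close>.\<close>

lemma hypergraph_on_subset_Ind:
  assumes "hypergraph_on r n X \<A> H"
  shows "H \<subseteq> Ind (topspace X)"
  using assms by (fastforce simp: hypergraph_on_def Cr_submanifold_def topspace_UConf Ind_def)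

lemma
  assumes "embedding_map X T f"
  shows embedding_map_imp_inj_on: "inj_on f (topspace X)"
    and embedding_map_imp_image_subset: "f ` topspace X \<subseteq> topspace T"
proof -
  have hom: "homeomorphic_map X (subtopology T (f ` topspace X)) f"
    using assms by (simp add: embedding_map_def)
  show "inj_on f (topspace X)"
    using hom by (rule homeomorphic_imp_injective_map)
  show "f ` topspace X \<subseteq> topspace T"
    using homeomorphic_imp_surjective_map[OF hom] unfolding topspace_subtopology by blast
qed

lemma linearly_independent_familyD:
  assumes "linearly_independent_family f \<sigma>"
    and "(\<Sum>x\<in>\<sigma>. dscale (a x) (f x)) = 0" and "x \<in> \<sigma>"
  shows "a x = 0"
proof -
  have "(\<Sum>x\<in>\<sigma>. dscale (a x) (f x)) = 0 \<longrightarrow> (\<forall>x\<in>\<sigma>. a x = 0)"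
    using assms(1) unfolding linearly_independent_family_def by (rule spec)
  then show ?thesis
    using assms by blast
qed

lemma linearly_independent_family_image:
  assumes "inj_on f \<sigma>"
  shows "linearly_independent_family (\<lambda>v. v) (f ` \<sigma>) \<longleftrightarrow> linearly_independent_family f \<sigma>"
proof
  assume L: "linearly_independent_family (\<lambda>v. v) (f ` \<sigma>)"
  show "linearly_independent_family f \<sigma>"
    unfolding linearly_independent_family_def
  proof (intro allI impI ballI)
    fix a x assume a: "(\<Sum>x\<in>\<sigma>. dscale (a x) (f x)) = 0"
      and x: "x \<in> \<sigma>"
    \<comment> \<open>Coefficients indexed by points become coefficients indexed by vectors through
      the inverse of \<open>f\<close> on \<open>\<sigma>\<close>.\<close>
    have "(\<Sum>v\<in>f ` \<sigma>. dscale (a (inv_into \<sigma> f v)) v) = 0"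
      using a by (simp_all add: sum.reindex[OF assms] inv_into_f_f[OF assms])
    then have "a (inv_into \<sigma> f (f x)) = 0"
      by (rule linearly_independent_familyD[OF L]) (rule imageI[OF x])
    then show "a x = 0"
      by (simp only: inv_into_f_f[OF assms x])
  qed
next
  assume L: "linearly_independent_family f \<sigma>"
  show "linearly_independent_family (\<lambda>v. v) (f ` \<sigma>)"
    unfolding linearly_independent_family_def
  proof (intro allI impI ballI)
    fix a v assume a: "(\<Sum>v\<in>f ` \<sigma>. dscale (a v) v) = 0"
      and "v \<in> f ` \<sigma>"
    then obtain x where x: "x \<in> \<sigma>" "v = f x"
      by blast
    \<comment> \<open>Conversely, coefficients on vectors are pulled back along \<open>f\<close>
      itself.\<close>
    have "(\<Sum>x\<in>\<sigma>. dscale (a (f x)) (f x)) = 0"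
      using a by (simp_all add: sum.reindex[OF assms])
    then show "a v = 0"
      unfolding x(2) using x(1) by (rule linearly_independent_familyD[OF L])
  qed
qed

lemma affinely_independent_familyD:
  assumes "affinely_independent_family f \<sigma>"
    and "(\<Sum>x\<in>\<sigma>. a x) = 0" and "(\<Sum>x\<in>\<sigma>. dscale (a x) (f x)) = 0" and "x \<in> \<sigma>"
  shows "a x = 0"
proof -
  have "(\<Sum>x\<in>\<sigma>. a x) = 0 \<and> (\<Sum>x\<in>\<sigma>. dscale (a x) (f x)) = 0 \<longrightarrow> (\<forall>x\<in>\<sigma>. a x = 0)"
    using assms(1) unfolding affinely_independent_family_def by (rule spec)
  then show ?thesis
    using assms by blast
qed

text \<open>The same transport of coefficients works for affine relations, because reindexing also
  preserves the sum of the coefficients.\<close>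

lemma affinely_independent_family_image:
  assumes "inj_on f \<sigma>"
  shows "affinely_independent_family (\<lambda>v. v) (f ` \<sigma>) \<longleftrightarrow> affinely_independent_family f \<sigma>"
proof
  assume L: "affinely_independent_family (\<lambda>v. v) (f ` \<sigma>)"
  show "affinely_independent_family f \<sigma>"
    unfolding affinely_independent_family_def
  proof (intro allI impI ballI)
    fix a x assume a: "(\<Sum>x\<in>\<sigma>. a x) = 0 \<and> (\<Sum>x\<in>\<sigma>. dscale (a x) (f x)) = 0"
      and x: "x \<in> \<sigma>"
    have "(\<Sum>v\<in>f ` \<sigma>. a (inv_into \<sigma> f v)) = 0"
      and "(\<Sum>v\<in>f ` \<sigma>. dscale (a (inv_into \<sigma> f v)) v) = 0"
      using a by (simp_all add: sum.reindex[OF assms] inv_into_f_f[OF assms])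
    then have "a (inv_into \<sigma> f (f x)) = 0"
      by (rule affinely_independent_familyD[OF L]) (rule imageI[OF x])
    then show "a x = 0"
      by (simp only: inv_into_f_f[OF assms x])
  qed
next
  assume L: "affinely_independent_family f \<sigma>"
  show "affinely_independent_family (\<lambda>v. v) (f ` \<sigma>)"
    unfolding affinely_independent_family_def
  proof (intro allI impI ballI)
    fix a v assume a: "(\<Sum>v\<in>f ` \<sigma>. a v) = 0 \<and> (\<Sum>v\<in>f ` \<sigma>. dscale (a v) v) = 0"
      and "v \<in> f ` \<sigma>"
    then obtain x where x: "x \<in> \<sigma>" "v = f x"
      by blast
    have "(\<Sum>x\<in>\<sigma>. a (f x)) = 0" and "(\<Sum>x\<in>\<sigma>. dscale (a (f x)) (f x)) = 0"
      using a by (simp_all add: sum.reindex[OF assms])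
    then show "a v = 0"
      unfolding x(2) using x(1) by (rule affinely_independent_familyD[OF L])
  qed
qed

text \<open>Links the vector space notion behind \<open>V_complex\<close> to families: over a finite
  set, dependence is witnessed by a nontrivial relation summed over the entire set.\<close>

lemma independent_iff_linearly_independent_family:
  assumes "finite S"
  shows "dvs.independent S \<longleftrightarrow> linearly_independent_family (\<lambda>v. v) S"
  unfolding dvs.dependent_finite[OF assms] linearly_independent_family_def by blast

text \<open>Stated over an arbitrary real normed field, so that the real and complex cases become
  instances of one argument.\<close>

lemma regular_embedding_iff_induces_injective_morphism:
  fixes f :: "'m \<Rightarrow> 'i \<Rightarrow>\<^sub>0 'k::real_normed_field"
  assumes T: "dsum_topology I T" and f: "Cs_embedding s n X \<A> T f"
    and H: "hypergraph_on r n X \<A> H"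
  shows "affinely_regular_embedding s n X \<A> T H f \<longleftrightarrow>
      induces_injective_morphism f H (A_complex I)"
    and "regular_embedding s n X \<A> T H f \<longleftrightarrow>
      induces_injective_morphism f H (V_complex I)"
proof -
  have emb: "embedding_map X T f"
    using f by (simp add: Cs_embedding_def)
  have inj: "inj_on f (topspace X)"
    using emb by (rule embedding_map_imp_inj_on)
  have im: "f ` topspace X \<subseteq> dsum I"
    using embedding_map_imp_image_subset[OF emb] T by (simp add: dsum_topology_def)
  have H_Ind: "finite \<sigma>" "\<sigma> \<subseteq> topspace X" if "\<sigma> \<in> H" for \<sigma>
    using hypergraph_on_subset_Ind[OF H] that by (auto simp: Ind_def)
  \<comment> \<open>Images under \<open>f\<close> are compared only for subsets of
    \<open>topspace X\<close>, where \<open>f\<close> is injective, so equal images come from equal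
    hyperedges.\<close>
  have inj_Ind: "inj_on (Ind_map f) H"
    using inj_on_image_eq_iff[OF inj] H_Ind(2) by (metis Ind_map_def inj_onI)
  have inj_\<sigma>: "inj_on f \<sigma>" if "\<sigma> \<in> H" for \<sigma>
    using inj H_Ind(2)[OF that] by (rule inj_on_subset)
  have f_Ind: "f ` \<sigma> \<in> Ind (dsum I)" if "\<sigma> \<in> H" for \<sigma>
    using H_Ind[OF that] im by (auto simp: Ind_def)
  have A: "Ind_map f \<sigma> \<in> A_complex I \<longleftrightarrow> (1 \<le> card \<sigma> \<longrightarrow> affinely_independent_family f \<sigma>)"
    if "\<sigma> \<in> H" for \<sigma>
  \<comment> \<open>The case \<open>k = 0\<close> allows the empty hyperedge. There the condition
    \<open>1 \<le> card \<sigma>\<close> makes the right side vacuous, and the left side holds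
    because the complex contains the empty set.\<close>
  proof (cases "\<sigma> = {}")
    case True
    then show ?thesis
      using f_Ind[OF that] by (simp add: A_complex_def Ind_map_def affinely_independent_family_def)
  next
    case False
    then have "1 \<le> card \<sigma>"
      using H_Ind(1)[OF that] by (simp add: Suc_le_eq card_gt_0_iff)
    then show ?thesis
      using f_Ind[OF that]
      by (simp add: A_complex_def Ind_map_def affinely_independent_family_image[OF inj_\<sigma>[OF that]])
  qed
  have V: "Ind_map f \<sigma> \<in> V_complex I \<longleftrightarrow> (1 \<le> card \<sigma> \<longrightarrow> linearly_independent_family f \<sigma>)"
    if "\<sigma> \<in> H" for \<sigma>
  proof (cases "\<sigma> = {}")
    case True
    then show ?thesis
      using f_Ind[OF that] by (simp add: V_complex_def Ind_map_def dvs.independent_empty)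
  next
    case False
    then have "1 \<le> card \<sigma>"
      using H_Ind(1)[OF that] by (simp add: Suc_le_eq card_gt_0_iff)
    then show ?thesis
      using f_Ind[OF that] H_Ind(1)[OF that]
      by (simp add: V_complex_def Ind_map_def independent_iff_linearly_independent_family
          linearly_independent_family_image[OF inj_\<sigma>[OF that]])
  qed
  show "affinely_regular_embedding s n X \<A> T H f \<longleftrightarrow>
      induces_injective_morphism f H (A_complex I)"
    \<comment> \<open>With \<open>f\<close> an embedding and \<open>Ind_map f\<close> injective on
      \<open>H\<close>, each side reduces to its condition on the individual hyperedges, and these
      conditions agree by \<open>A\<close>.\<close>
    using f inj_Ind A
    by (simp add: affinely_regular_embedding_def induces_injective_morphism_def image_subset_iff)
  show "regular_embedding s n X \<A> T H f \<longleftrightarrow>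
      induces_injective_morphism f H (V_complex I)"
    using f inj_Ind V
    by (simp add: regular_embedding_def induces_injective_morphism_def image_subset_iff)
qed

theorem proposition8p5:
  fixes r s :: enat and n :: nat
    and X :: "'m topology" and \<A> :: "'m chart set" and I :: "'i set"
  assumes "1 \<le> r" and "s \<le> r"
    and "Cr_manifold r n X \<A>"
  shows
    "(\<forall>(T :: ('i \<Rightarrow>\<^sub>0 real) topology) f H.
        dsum_topology I T \<and> Cs_embedding s n X \<A> T f \<and> hypergraph_on r n X \<A> H \<longrightarrow>
          (affinely_regular_embedding s n X \<A> T H f \<longleftrightarrow>
             induces_injective_morphism f H (A_complex I)) \<and>
          (regular_embedding s n X \<A> T H f \<longleftrightarrow>
             induces_injective_morphism f H (V_complex I))) \<and>
     (\<forall>(T :: ('i \<Rightarrow>\<^sub>0 complex) topology) f H.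
        dsum_topology I T \<and> Cs_embedding s n X \<A> T f \<and> hypergraph_on r n X \<A> H \<longrightarrow>
          (affinely_regular_embedding s n X \<A> T H f \<longleftrightarrow>
             induces_injective_morphism f H (A_complex I)) \<and>
          (regular_embedding s n X \<A> T H f \<longleftrightarrow>
             induces_injective_morphism f H (V_complex I)))"
  \<comment> \<open>Four goals arise, affine and linear over the reals and over the complex numbers;
    each is an instance of one half of the general lemma.\<close>
  by (intro conjI allI impI; elim conjE; rule regular_embedding_iff_induces_injective_morphism; assumption)

end
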